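(* Let $l$ be a positive integer. For every integer $n\geq l$, the number \[ C_l(n)=\frac{1}{(n+1)^l}\binom{(l+1)n}{n,n,\ldots,n}=\frac{1}{(n+1)^l}\cdot\frac{((l+1)n)!}{(n!)^{l+1}} \] is an integer.
   Context: $\binom{(l+1)n}{n,n,\ldots,n}$ denotes the central multinomial coefficient with $l+1$ lower entries all equal to $n$. The numbers $C_l(n)$ are called multinomial Catalan numbers; $l=1$ gives the usual Catalan numbers. *)

theory Defs
  imports Complex_Main
begin

text \<open>
  The quotients below are taken in \<^typ>\<open>rat\<close>, so that no truncating division hides the
  question of integrality.
\<close>

definition multinomial :: "nat list \<Rightarrow> rat" where
  "multinomial ks = fact (sum_list ks) / prod_list (map fact ks)"

definition multinomial_Catalan :: "nat \<Rightarrow> nat \<Rightarrow> rat" where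
  "multinomial_Catalan l n = 1 / (of_nat n + 1) ^ l * multinomial (replicate (l + 1) n)"

end

theory Submission
  imports Defs "HOL-Computational_Algebra.Primes"
begin

text \<open>
  The claim is that \<open>n! ((n + 1)!)\<^sup>l\<close> divides \<open>((l + 1) n)!\<close>; it is checked at each prime \<open>p\<close> by
  Legendre's formula. At the power \<open>p\<^sup>k\<close> the left side exceeds the right side by at most
  \<open>\<lfloor>l / p\<^sup>k\<rfloor>\<close>. Let \<open>p\<^sup>s \<le> n + 1 < p\<^sup>s\<^sup>+\<^sup>1\<close>. At the powers \<open>p\<^sup>s\<^sup>+\<^sup>k\<close> with \<open>k \<ge> 1\<close> the left side
  contributes nothing, whereas \<open>l p\<^sup>s \<le> (l + 1) n\<close> shows that the right side contributes at least
  \<open>\<lfloor>l / p\<^sup>k\<rfloor>\<close>, which pays for the deficit at \<open>p\<^sup>k\<close>. The hypothesis \<open>l \<le> n\<close> is what gives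
  \<open>l p\<^sup>s \<le> (l + 1) n\<close> when \<open>n + 1 = p\<^sup>s\<close>.
\<close>

lemma multiplicity_eq_sum_of_bool_dvd:
  fixes p m L :: nat
  assumes "prime p" "0 < m" "m < p ^ Suc L"
  shows "multiplicity p m = (\<Sum>k=1..L. of_bool (p ^ k dvd m))"
proof -
  have finite_mult: "m \<noteq> 0" "\<not> is_unit p"
    using assms by auto
  have "p ^ multiplicity p m \<le> m"
    using assms by (intro dvd_imp_le multiplicity_dvd) auto
  hence "p ^ multiplicity p m < p ^ Suc L"
    using assms by linarith
  with prime_gt_1_nat[OF assms(1)] have "multiplicity p m < Suc L"
    by (rule power_less_imp_less_exp)
  hence "{k \<in> {1..L}. p ^ k dvd m} = {1..multiplicity p m}"
    by (auto simp: power_dvd_iff_le_multiplicity[OF finite_mult])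
  thus ?thesis
    by (simp add: of_bool_def sum.If_cases Int_def)
qed

text \<open>Legendre's formula by induction: from \<open>n\<close> to \<open>n + 1\<close> the term
  at \<open>k\<close> grows by one exactly when \<open>p ^ k\<close> divides \<open>n + 1\<close>.
  The free cutoff \<open>L\<close> lets factorials of different size be summed over chosen
  ranges.\<close>

lemma multiplicity_fact_nat:
  fixes p n L :: nat
  assumes "prime p" "n < p ^ Suc L"
  shows "multiplicity p (fact n :: nat) = (\<Sum>k=1..L. n div p ^ k)"
  using assms(2)
proof (induction n)
  case 0
  show ?case by simp
next
  case (Suc n)
  have "multiplicity p (fact (Suc n) :: nat) = multiplicity p (Suc n) + multiplicity p (fact n :: nat)"
    unfolding fact_Suc of_nat_id using assms(1)
    by (intro prime_elem_multiplicity_mult_distrib) auto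
  also have "\<dots> = (\<Sum>k=1..L. of_bool (p ^ k dvd Suc n) + n div p ^ k)"
    using Suc assms(1) by (simp add: multiplicity_eq_sum_of_bool_dvd sum.distrib)
  also have "\<dots> = (\<Sum>k=1..L. Suc n div p ^ k)"
    by (intro sum.cong refl) (auto simp: div_Suc dvd_eq_mod_eq_0)
  finally show ?case .
qed

text \<open>If \<open>q\<close> divides \<open>n + 1\<close>, then \<open>n\<close> and
  \<open>n + l * (n + 1) = (l + 1) * n + l\<close> are both -1 modulo \<open>q\<close>. Otherwise
  \<open>n\<close> and \<open>n + 1\<close> have the same quotient, and superadditivity of the floor
  suffices even without \<open>l div q\<close>.\<close>

lemma div_add_mult_Suc_div_le:
  fixes n l q :: nat
  assumes "0 < q"
  shows "n div q + l * (Suc n div q) \<le> (Suc l * n) div q + l div q"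
proof (cases "q dvd Suc n")
  case True
  then obtain a where a: "Suc n = q * a" ..
  have "(n + l * Suc n) mod q = n mod q"
    by (simp add: a mult.left_commute[of l q a] del: mult_Suc_right)
  also have n_mod: "n mod q = q - 1"
    using True mod_Suc[of n q] assms by (auto simp: dvd_eq_mod_eq_0 split: if_splits)
  finally have "(Suc l * n + l) mod q = q - 1"
    by (simp add: algebra_simps)
  \<comment> \<open>The residue of the sum is maximal, so adding the two residues produces no carry.\<close>
  moreover have "(x + y) div q = x div q + y div q" if "(x + y) mod q = q - 1" for x y
  proof -
    have lt: "x mod q < q" "y mod q < q"
      using assms by auto
    have "x mod q + y mod q < q"
    proof (rule ccontr)
      assume ge: "\<not> ?thesis"
      have "x mod q + y mod q - q < q"
        using lt by linarith
      hence "(x mod q + y mod q) mod q = x mod q + y mod q - q"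
        using ge by (simp add: le_mod_geq)
      thus False
        using that lt ge unfolding mod_add_eq by linarith
    qed
    thus ?thesis
      by (subst div_add1_eq) simp
  qed
  ultimately have "(Suc l * n) div q + l div q = (Suc l * n + l) div q"
    by simp
  also have "Suc l * n + l = n + q * (l * a)"
    using arg_cong[OF a, of "\<lambda>x. l * x"] by (simp add: algebra_simps)
  also have "\<dots> div q = n div q + l * (Suc n div q)"
    using assms by (simp add: a)
  finally show ?thesis
    by simp
next
  case False
  hence "Suc n div q = n div q"
    by (simp add: div_Suc dvd_eq_mod_eq_0)
  moreover have "Suc l * (n div q) * q \<le> Suc l * n"
    unfolding mult.assoc by (intro mult_le_mono2 div_times_less_eq_dividend)
  hence "Suc l * (n div q) \<le> (Suc l * n) div q"
    using assms by (simp only: less_eq_div_iff_mult_less_eq)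
  ultimately show ?thesis
    by simp
qed

lemma fact_mult_fact_Suc_power_dvd:
  fixes n l :: nat
  assumes "l \<le> n"
  shows "fact n * fact (Suc n) ^ l dvd (fact (Suc l * n) :: nat)"
proof (rule multiplicity_le_imp_dvd)
  fix p :: nat
  assume p: "prime p"
  have p2: "2 \<le> p"
    using p by (rule prime_ge_2_nat)
  obtain s where s: "p ^ s \<le> Suc n" "Suc n < p ^ Suc s"
    using ex_power_ivl1[OF p2, of "Suc n"] by auto
  have big: "l * p ^ s \<le> Suc l * n"
  proof (cases "p ^ s = Suc n")
    case True
    thus ?thesis using assms by simp
  next
    case False
    have "l * p ^ s \<le> l * n"
      using False s by (intro mult_le_mono2) simp
    also have "\<dots> \<le> Suc l * n"
      by simp
    finally show ?thesis .
  qed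
  \<comment> \<open>The first \<open>s\<close> separates the two ranges, the second makes room for
    the shifted indices \<open>s + k\<close> with \<open>k \<le> s\<close>, and the last summand
    forces \<open>(l + 1) * n < p ^ (L + 1)\<close>.\<close>
  define L where "L = s + (s + Suc l * n)"
  have "Suc l * n < 2 ^ (Suc l * n)"
    by (rule less_exp)
  also have "\<dots> \<le> p ^ (Suc l * n)"
    using p2 by (rule power_mono) simp
  also have "\<dots> \<le> p ^ Suc L"
    using p2 by (intro power_increasing) (auto simp: L_def)
  finally have ltL: "Suc l * n < p ^ Suc L" .
  define f where "f = (\<lambda>k. (Suc l * n) div p ^ k)"
  define g where "g = (\<lambda>k. n div p ^ k + l * (Suc n div p ^ k))"
  have "multiplicity p (fact n * fact (Suc n) ^ l :: nat)
      = multiplicity p (fact n :: nat) + l * multiplicity p (fact (Suc n) :: nat)"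
    using p by (simp add: prime_elem_multiplicity_mult_distrib prime_elem_multiplicity_power_distrib
        del: fact_Suc)
  \<comment> \<open>Since \<open>n + 1 < p ^ (s + 1)\<close>, the cutoff \<open>s\<close> serves
    both factorials.\<close>
  also have "\<dots> = (\<Sum>k=1..s. g k)"
    using p s multiplicity_fact_nat[of p n s] multiplicity_fact_nat[of p "Suc n" s]
    by (simp add: g_def sum.distrib sum_distrib_left del: fact_Suc)
  also have "\<dots> \<le> (\<Sum>k=1..s. f k + l div p ^ k)"
    unfolding f_def g_def using p2 by (intro sum_mono div_add_mult_Suc_div_le) simp
  also have "\<dots> = (\<Sum>k=1..s. f k) + (\<Sum>k=1..s. l div p ^ k)"
    by (rule sum.distrib)
  also have "(\<Sum>k=1..s. l div p ^ k) \<le> (\<Sum>k=1..s. f (s + k))"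
  proof (rule sum_mono)
    fix k
    have "l div p ^ k = (l * p ^ s) div p ^ (s + k)"
      using p2 by (simp add: power_add mult.commute)
    also have "\<dots> \<le> f (s + k)"
      unfolding f_def using big by (rule div_le_mono)
    finally show "l div p ^ k \<le> f (s + k)" .
  qed
  \<comment> \<open>Nonnegative terms are added so that the shifted indices fill
    \<open>s + 1\<close> to \<open>L\<close>.\<close>
  also have "\<dots> \<le> (\<Sum>k=1..s + Suc l * n. f (s + k))"
    by (rule sum_mono2) auto
  also have "\<dots> = (\<Sum>k=Suc s..L. f k)"
    using sum.shift_bounds_cl_nat_ivl[of f 1 s "s + Suc l * n"]
    by (simp add: L_def add.commute add.left_commute)
  also have "(\<Sum>k=1..s. f k) + (\<Sum>k=Suc s..L. f k) = (\<Sum>k=1..L. f k)"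
    using sum.ub_add_nat[of 1 s f "s + Suc l * n"] by (simp add: L_def)
  also have "\<dots> = multiplicity p (fact (Suc l * n) :: nat)"
    unfolding f_def using p ltL by (simp only: multiplicity_fact_nat)
  finally show "multiplicity p (fact n * fact (Suc n) ^ l :: nat)
      \<le> multiplicity p (fact (Suc l * n) :: nat)"
    by simp
qed (simp del: fact_Suc)

theorem theorem1:
  fixes l n :: nat
  assumes "l \<ge> 1" and "n \<ge> l"
  shows "multinomial_Catalan l n = 1 / (of_nat n + 1) ^ l * (fact ((l + 1) * n) / (fact n) ^ (l + 1))
    \<and> multinomial_Catalan l n \<in> \<int>"
proof
  show eq: "multinomial_Catalan l n
      = 1 / (of_nat n + 1) ^ l * (fact ((l + 1) * n) / (fact n) ^ (l + 1))"
    by (simp add: multinomial_Catalan_def multinomial_def sum_list_replicate)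
  obtain c :: nat where "fact (Suc l * n) = fact n * fact (Suc n) ^ l * c"
    using fact_mult_fact_Suc_power_dvd[OF assms(2)] ..
  \<comment> \<open>Splitting \<open>(n + 1)!\<close> as \<open>(n + 1) * n!\<close> turns the
    divisor into \<open>(n + 1) ^ l * (n!) ^ (l + 1)\<close>, the denominator of the
    quotient.\<close>
  hence "(of_nat (fact (Suc l * n)) :: rat) = of_nat (fact n * (Suc n * fact n) ^ l * c)"
    unfolding fact_Suc of_nat_id by (rule arg_cong)
  hence "(fact ((l + 1) * n) :: rat) = ((of_nat n + 1) ^ l * fact n ^ (l + 1)) * of_nat c"
    unfolding power_mult_distrib by (simp add: mult_ac add.commute)
  moreover have "(of_nat n + 1 :: rat) ^ l * fact n ^ (l + 1) \<noteq> 0"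
    using of_nat_neq_0[of n, where 'a = rat] by (simp add: add.commute)
  ultimately have "multinomial_Catalan l n = of_nat c"
    unfolding eq by (simp add: field_simps)
  thus "multinomial_Catalan l n \<in> \<int>"
    by simp
qed

end
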